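(* Let $S$ be the Baker transformation with discontinuity at $a\in(0,1)$ and let $F(\theta,y)=(S\theta,f_\theta(y))$ be a skew product satisfying the standing assumptions in the context. Then either $P\subseteq L$ or $\tilde C^+\cap\tilde C^-=\tilde P\subseteq P$.
   Context: Base map. Points of $\Theta=\mathbb{T}^2=\mathbb{R}^2/\mathbb{Z}^2$ are identified with points $(\xi,x)$ of $\mathbb{A}^2$, $\mathbb{A}=[0,1)$. For $a\in(0,1)$, the Baker transformation is the bijection $S(\xi,x)=(\tau(\xi),ax)$ if $\xi\in[0,a)$ and $S(\xi,x)=(\tau(\xi),a+(1-a)x)$ if $\xi\in[a,1)$, where $\tau(\xi)=a^{-1}\xi$ on $[0,a)$ and $\tau(\xi)=(1-a)^{-1}(\xi-a)$ on $[a,1)$. Skew product. $\mathbb{I}=[-M,M]$ is a compact interval and $F(\theta,y)=(S\theta,f_\theta(y))$ on $\Theta\times\mathbb{I}$, where the fibre maps $f_\theta:\mathbb{I}\to(-M,M)$ are uniformly bounded increasing $C^3$ maps with $\inf_{(\theta,y)}f'_\theta(y)>0$ and $\sup_{(\theta,y)}\mathcal{S}f_\theta(y)<0$; primes denote derivatives in $y$ and $\mathcal{S}f_\theta=\frac{f_\theta'''}{f_\theta'}-\frac32\big(\frac{f_\theta''}{f_\theta'}\big)^2$. Write $f_\theta^n=f_{S^{n-1}\theta}\circ\cdots\circ f_\theta$. Standing hypotheses. (A) There is a constant $K_0$ with $\sup_y|f_\theta(y)-f_{\theta'}(y)|+\sup_y|f'_\theta(y)-f'_{\theta'}(y)|\le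 K_0\,d(\theta,\theta')$ for all $\theta,\theta'$, where $d$ is the metric of $\mathbb{T}^2$. (B) $\Pi(\xi,x)=x$ satisfies $\tau\circ\Pi=\Pi\circ S^{-1}$, and there are an injection $\sigma:\mathbb{T}^1\to\Theta$, Hölder continuous on monotonicity intervals of $\tau$, with $\Pi\circ\sigma=\mathrm{id}$, and constants $C>0$, $\alpha\in(0,1)$ with $d(S^{-n}\theta,S^{-n}(\sigma\Pi\theta))\le C\alpha^n d(\theta,\sigma\Pi\theta)$ for all $\theta$ and $n>0$. (C) $\alpha\cdot\sup_{(\theta,y)}f'_\theta(y)<1$ and $\sup_{(\theta,y)}|(\log f'_\theta(y))'|<\infty$. Notation. $\phi_n^{\pm}(\theta):=f^n_{S^{-n}\theta}(\pm M)$, $\phi^{\pm}(\theta):=\lim_{n\to\infty}\phi_n^{\pm}(\theta)$ (monotone limits), $P:=\{\theta:\phi^+(\theta)=\phi^-(\theta)\}$. $L:=\bigcup_{k=0}^\infty S^k(\mathbb{A}\times\{a\})$, the set of all discontinuity points of the maps $S^{-n}$, $n\ge1$. $\tilde\phi^+(\theta):=\lim_{r\to0}\sup\{\phi^+(\theta'):|\theta'-\theta|<r\}$, $\tilde\phi^-(\theta):=\lim_{r\to0}\inf\{\phi^-(\theta'):|\theta'-\theta|<r\}$. $\tilde P:=\{\theta:\tilde\phi^+(\theta)=\tilde\phi^-(\theta)\}$, and $\tilde C^{\pm}$ is the set of continuity points of $\tilde\phi^{\pm}$. In these definitions, distances, neighbourhoods and continuity are taken in $\mathbb{A}^2=[0,1)^2$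 with the Euclidean metric. *)

theory Defs
  imports "HOL-Analysis.Analysis"
begin

text \<open>Points of the torus are represented by the fundamental domain \<open>[0,1)\<^sup>2\<close>; functions on the
  torus are functions on \<open>real \<times> real\<close> whose values outside \<open>Theta\<close> are irrelevant. Since the
  type \<open>real \<times> real\<close> carries the Euclidean metric, \<open>dist\<close> is the Euclidean metric of \<open>[0,1)\<^sup>2\<close>.\<close>

definition Theta :: "(real \<times> real) set" where
  "Theta = {0..<1} \<times> {0..<1}"

text \<open>The quotient metrics of \<open>\<real>/\<int>\<close> and \<open>\<real>\<^sup>2/\<int>\<^sup>2\<close> on representatives.\<close>

definition circle_dist :: "real \<Rightarrow> real \<Rightarrow> real" where
  "circle_dist x y = infdist x ((+) y ` \<int>)"

definition torus_dist :: "real \<times> real \<Rightarrow> real \<times> real \<Rightarrow> real" where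
  "torus_dist p q = infdist p ((+) q ` (\<int> \<times> \<int>))"

definition tau :: "real \<Rightarrow> real \<Rightarrow> real" where
  "tau a \<xi> = (if \<xi> < a then \<xi> / a else (\<xi> - a) / (1 - a))"

definition baker :: "real \<Rightarrow> real \<times> real \<Rightarrow> real \<times> real" where
  "baker a = (\<lambda>(\<xi>, x). if \<xi> < a then (tau a \<xi>, a * x) else (tau a \<xi>, a + (1 - a) * x))"

definition baker_inv :: "real \<Rightarrow> real \<times> real \<Rightarrow> real \<times> real" where
  "baker_inv a = inv_into Theta (baker a)"

lemma bij_betw_baker:
  assumes "0 < a" "a < 1"
  shows "bij_betw (baker a) Theta Theta"
proof (rule bij_betw_byWitness[where f' = "\<lambda>(\<xi>, x). if x < a then (a * \<xi>, x / a)
      else (a + (1 - a) * \<xi>, (x - a) / (1 - a))"])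
  have sc: "0 \<le> c * t \<and> c * t < c" if "0 < c" "0 \<le> t" "t < 1" for c t :: real
    using that mult_strict_left_mono[of t 1 c] by simp
  have a1: "0 < 1 - a" using assms by simp
  have sc': "\<not> (1 - a) * t < 0" "\<not> a * t < 0" if "0 \<le> t" for t
    using that assms by (auto simp: not_less)
  show "\<forall>\<theta>\<in>Theta. (case baker a \<theta> of (\<xi>, x) \<Rightarrow> if x < a then (a * \<xi>, x / a)
      else (a + (1 - a) * \<xi>, (x - a) / (1 - a))) = \<theta>"
    using assms sc[of a] sc'
    by (auto simp: Theta_def baker_def tau_def)
  show "\<forall>\<theta>\<in>Theta. baker a (case \<theta> of (\<xi>, x) \<Rightarrow> if x < a then (a * \<xi>, x / a)
      else (a + (1 - a) * \<xi>, (x - a) / (1 - a))) = \<theta>"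
    using assms sc[of a] sc'
    by (auto simp: Theta_def baker_def tau_def)
  show "baker a ` Theta \<subseteq> Theta"
  proof
    fix q assume "q \<in> baker a ` Theta"
    then obtain \<xi> x where q: "q = baker a (\<xi>, x)"
      and *: "0 \<le> \<xi>" "\<xi> < 1" "0 \<le> x" "x < 1"
      by (auto simp: Theta_def)
    have "0 \<le> a * x" "a * x < 1" "0 \<le> a + (1 - a) * x" "a + (1 - a) * x < 1"
      using assms sc[OF assms(1) *(3) *(4)] sc[OF a1 *(3) *(4)] by linarith+
    then show "q \<in> Theta"
      using * assms by (auto simp: q Theta_def baker_def tau_def divide_less_eq)
  qed
  show "(\<lambda>(\<xi>, x). if x < a then (a * \<xi>, x / a) else (a + (1 - a) * \<xi>, (x - a) / (1 - a))) ` Theta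
      \<subseteq> Theta"
  proof
    fix q assume "q \<in> (\<lambda>(\<xi>, x). if x < a then (a * \<xi>, x / a) else (a + (1 - a) * \<xi>, (x - a) / (1 - a))) ` Theta"
    then obtain \<xi> x where q: "q = (\<lambda>(\<xi>, x). if x < a then (a * \<xi>, x / a) else (a + (1 - a) * \<xi>, (x - a) / (1 - a))) (\<xi>, x)"
      and *: "0 \<le> \<xi>" "\<xi> < 1" "0 \<le> x" "x < 1"
      by (auto simp: Theta_def)
    have "0 \<le> a * \<xi>" "a * \<xi> < 1" "0 \<le> a + (1 - a) * \<xi>" "a + (1 - a) * \<xi> < 1"
      using assms sc[OF assms(1) *(1) *(2)] sc[OF a1 *(1) *(2)] by linarith+
    then show "q \<in> Theta"
      using * assms by (auto simp: q Theta_def baker_def tau_def divide_less_eq)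
  qed
qed

text \<open>Derivatives on the compact fibre interval are taken within the interval, hence are
  one-sided at its end points.\<close>

definition nderiv_on :: "real set \<Rightarrow> nat \<Rightarrow> (real \<Rightarrow> real) \<Rightarrow> real \<Rightarrow> real" where
  "nderiv_on I n = ((\<lambda>g y. vector_derivative g (at y within I)) ^^ n)"

definition C3_on :: "real set \<Rightarrow> (real \<Rightarrow> real) \<Rightarrow> bool" where
  "C3_on I g \<longleftrightarrow> (\<forall>k<3. nderiv_on I k g differentiable_on I) \<and> continuous_on I (nderiv_on I 3 g)"

definition schwarzian_on :: "real set \<Rightarrow> (real \<Rightarrow> real) \<Rightarrow> real \<Rightarrow> real" where
  "schwarzian_on I g y = nderiv_on I 3 g y / nderiv_on I 1 g y
     - 3 / 2 * (nderiv_on I 2 g y / nderiv_on I 1 g y)\<^sup>2"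

text \<open>Real suprema are accompanied by an explicit boundedness condition wherever boundedness is
  not already forced by the other conditions.\<close>

definition fibre_maps :: "real \<Rightarrow> (real \<times> real \<Rightarrow> real \<Rightarrow> real) \<Rightarrow> bool" where
  "fibre_maps M f \<longleftrightarrow>
     (\<forall>\<theta>\<in>Theta. f \<theta> ` {-M..M} \<subseteq> {-M<..<M} \<and> strict_mono_on {-M..M} (f \<theta>) \<and> C3_on {-M..M} (f \<theta>)) \<and>
     (INF (\<theta>, y)\<in>Theta \<times> {-M..M}. nderiv_on {-M..M} 1 (f \<theta>) y) > 0 \<and>
     bdd_above ((\<lambda>(\<theta>, y). schwarzian_on {-M..M} (f \<theta>) y) ` (Theta \<times> {-M..M})) \<and>
     (SUP (\<theta>, y)\<in>Theta \<times> {-M..M}. schwarzian_on {-M..M} (f \<theta>) y) < 0"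

definition hyp_A :: "real \<Rightarrow> (real \<times> real \<Rightarrow> real \<Rightarrow> real) \<Rightarrow> bool" where
  "hyp_A M f \<longleftrightarrow> (\<exists>K\<^sub>0. \<forall>\<theta>\<in>Theta. \<forall>\<theta>'\<in>Theta.
     (SUP y\<in>{-M..M}. \<bar>f \<theta> y - f \<theta>' y\<bar>) +
     (SUP y\<in>{-M..M}. \<bar>nderiv_on {-M..M} 1 (f \<theta>) y - nderiv_on {-M..M} 1 (f \<theta>') y\<bar>)
       \<le> K\<^sub>0 * torus_dist \<theta> \<theta>')"

text \<open>Hoelder continuity with respect to the quotient metrics.\<close>

definition holder_on :: "real set \<Rightarrow> (real \<Rightarrow> real \<times> real) \<Rightarrow> bool" where
  "holder_on J \<sigma> \<longleftrightarrow> (\<exists>H \<beta>. 0 < \<beta> \<and> \<beta> \<le> 1 \<and>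
     (\<forall>x\<in>J. \<forall>y\<in>J. torus_dist (\<sigma> x) (\<sigma> y) \<le> H * circle_dist x y powr \<beta>))"

text \<open>The projection \<open>\<Pi>(\<xi>,x) = x\<close> is \<open>snd\<close>; the monotonicity intervals of \<open>\<tau>\<close> are
  \<open>[0,a)\<close> and \<open>[a,1)\<close>.\<close>

definition hyp_B :: "real \<Rightarrow> real \<Rightarrow> bool" where
  "hyp_B a \<alpha> \<longleftrightarrow>
     (\<forall>\<theta>\<in>Theta. tau a (snd \<theta>) = snd (baker_inv a \<theta>)) \<and> 0 < \<alpha> \<and> \<alpha> < 1 \<and>
     (\<exists>\<sigma> C. \<sigma> ` {0..<1} \<subseteq> Theta \<and> inj_on \<sigma> {0..<1} \<and>
        holder_on {0..<a} \<sigma> \<and> holder_on {a..<1} \<sigma> \<and>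
        (\<forall>x\<in>{0..<1}. snd (\<sigma> x) = x) \<and> C > 0 \<and>
        (\<forall>\<theta>\<in>Theta. \<forall>n>0. torus_dist ((baker_inv a ^^ n) \<theta>) ((baker_inv a ^^ n) (\<sigma> (snd \<theta>)))
           \<le> C * \<alpha> ^ n * torus_dist \<theta> (\<sigma> (snd \<theta>))))"

definition hyp_C :: "real \<Rightarrow> (real \<times> real \<Rightarrow> real \<Rightarrow> real) \<Rightarrow> real \<Rightarrow> bool" where
  "hyp_C M f \<alpha> \<longleftrightarrow>
     bdd_above ((\<lambda>(\<theta>, y). nderiv_on {-M..M} 1 (f \<theta>) y) ` (Theta \<times> {-M..M})) \<and>
     \<alpha> * (SUP (\<theta>, y)\<in>Theta \<times> {-M..M}. nderiv_on {-M..M} 1 (f \<theta>) y) < 1 \<and>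
     bdd_above ((\<lambda>(\<theta>, y). \<bar>nderiv_on {-M..M} 1 (\<lambda>z. ln (nderiv_on {-M..M} 1 (f \<theta>) z)) y\<bar>)
       ` (Theta \<times> {-M..M}))"

text \<open>\<open>fibre_iter a f n \<theta>\<close> is the composition of \<open>f\<close> along \<open>\<theta>, S \<theta>, \<dots>, S\<^sup>n\<^sup>-\<^sup>1 \<theta>\<close>.\<close>

primrec fibre_iter ::
    "real \<Rightarrow> (real \<times> real \<Rightarrow> real \<Rightarrow> real) \<Rightarrow> nat \<Rightarrow> real \<times> real \<Rightarrow> real \<Rightarrow> real" where
  "fibre_iter a f 0 \<theta> = id"
| "fibre_iter a f (Suc n) \<theta> = f ((baker a ^^ n) \<theta>) \<circ> fibre_iter a f n \<theta>"

text \<open>\<open>phi a f y\<close> is the pullback limit started at height \<open>y\<close>, so \<open>\<phi>\<^sup>+\<close> and \<open>\<phi>\<^sup>-\<close>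
  are \<open>phi a f M\<close> and \<open>phi a f (-M)\<close>.\<close>

definition phi :: "real \<Rightarrow> (real \<times> real \<Rightarrow> real \<Rightarrow> real) \<Rightarrow> real \<Rightarrow> real \<times> real \<Rightarrow> real" where
  "phi a f y \<theta> = lim (\<lambda>n. fibre_iter a f n ((baker_inv a ^^ n) \<theta>) y)"

definition P_set :: "real \<Rightarrow> real \<Rightarrow> (real \<times> real \<Rightarrow> real \<Rightarrow> real) \<Rightarrow> (real \<times> real) set" where
  "P_set a M f = {\<theta>\<in>Theta. phi a f M \<theta> = phi a f (-M) \<theta>}"

definition L_set :: "real \<Rightarrow> (real \<times> real) set" where
  "L_set a = (\<Union>k. (baker a ^^ k) ` ({0..<1} \<times> {a}))"

definition phi_tilde_plus ::
    "real \<Rightarrow> real \<Rightarrow> (real \<times> real \<Rightarrow> real \<Rightarrow> real) \<Rightarrow> real \<times> real \<Rightarrow> real" where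
  "phi_tilde_plus a M f \<theta> = Lim (at_right 0) (\<lambda>r. SUP \<theta>'\<in>{\<theta>'\<in>Theta. dist \<theta>' \<theta> < r}. phi a f M \<theta>')"

definition phi_tilde_minus ::
    "real \<Rightarrow> real \<Rightarrow> (real \<times> real \<Rightarrow> real \<Rightarrow> real) \<Rightarrow> real \<times> real \<Rightarrow> real" where
  "phi_tilde_minus a M f \<theta> = Lim (at_right 0) (\<lambda>r. INF \<theta>'\<in>{\<theta>'\<in>Theta. dist \<theta>' \<theta> < r}. phi a f (-M) \<theta>')"

definition P_tilde :: "real \<Rightarrow> real \<Rightarrow> (real \<times> real \<Rightarrow> real \<Rightarrow> real) \<Rightarrow> (real \<times> real) set" where
  "P_tilde a M f = {\<theta>\<in>Theta. phi_tilde_plus a M f \<theta> = phi_tilde_minus a M f \<theta>}"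

definition C_tilde_plus :: "real \<Rightarrow> real \<Rightarrow> (real \<times> real \<Rightarrow> real \<Rightarrow> real) \<Rightarrow> (real \<times> real) set" where
  "C_tilde_plus a M f = {\<theta>\<in>Theta. continuous (at \<theta> within Theta) (phi_tilde_plus a M f)}"

definition C_tilde_minus :: "real \<Rightarrow> real \<Rightarrow> (real \<times> real \<Rightarrow> real \<Rightarrow> real) \<Rightarrow> (real \<times> real) set" where
  "C_tilde_minus a M f = {\<theta>\<in>Theta. continuous (at \<theta> within Theta) (phi_tilde_minus a M f)}"

end

theory Submission
  imports Defs
begin

text \<open>
  Write \<open>\<psi>\<^sup>+\<close> and \<open>\<psi>\<^sup>-\<close> for the envelopes \<open>phi_tilde_plus\<close> and \<open>phi_tilde_minus\<close>. The envelope \<open>\<psi>\<^sup>+\<close>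
  is upper semicontinuous and lies above \<open>\<phi>\<^sup>+\<close>, the envelope \<open>\<psi>\<^sup>-\<close> is lower semicontinuous and lies
  below \<open>\<phi>\<^sup>-\<close>, and \<open>\<phi>\<^sup>- \<le> \<phi>\<^sup>+\<close>. Where the two envelopes meet, they squeeze everything in between, so
  such points belong to \<open>P\<close>; moreover each envelope inherits the missing half of continuity from the
  other one (\<open>P_tilde_subset_P\<close>, \<open>P_tilde_subset_C_tilde\<close>). What remains is that the envelopes meet
  wherever both are continuous. If \<open>P\<close> is empty, it is contained in \<open>L\<close>, so let \<open>P\<close> be nonempty. At
  a common continuity point the envelopes agree as soon as there are points arbitrarily close by at
  which they are arbitrarily close to each other. Such points are found in two steps.

  First, \<open>P\<close> is dense (\<open>P_dense\<close>). Two points on the same horizontal fibre have backward orbits that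
  approach each other at rate \<open>\<alpha>\<close>, hence the bounding graphs over the two \<open>m\<close>-th preimages differ by
  \<open>O(\<alpha>\<^sup>m)\<close>. If one of the points is pinched, then the gap \<open>\<phi>\<^sup>+ - \<phi>\<^sup>-\<close> over the \<open>m\<close>-th preimage of the
  other is \<open>O(\<alpha>\<^sup>m)\<close>, and pushing it forward by \<open>m\<close> steps multiplies it by at most \<open>\<Lambda>\<^sup>m\<close>, where \<open>\<Lambda>\<close>
  is the supremum of the fibre derivatives. Because \<open>\<alpha>\<Lambda> < 1\<close>, the other point is pinched as well
  (\<open>P_fibre_saturated\<close>). So \<open>P\<close> is a union of horizontal fibres, and being invariant under \<open>S\<close> it
  contains with height \<open>x\<close> all heights in the dense set \<open>\<Union>\<^sub>k \<tau>\<^sup>-\<^sup>k(x)\<close>.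

  Secondly, every pinched point \<open>\<theta>\<close> is approximated by open sets on which \<open>\<phi>\<^sup>+\<close> and \<open>\<phi>\<^sup>-\<close> are confined to
  a common short interval (\<open>nearly_pinched_ball_near_P\<close>). For \<open>n\<close> large, \<open>\<phi>\<^sub>n\<^sup>+(\<theta>)\<close> and \<open>\<phi>\<^sub>n\<^sup>-(\<theta>)\<close> are
  close. The maps \<open>S\<^sup>-\<^sup>n\<close> may jump at \<open>\<theta>\<close>, but only when the height is approached from below, so
  \<open>\<phi>\<^sub>n\<^sup>\<plusminus>\<close> are nearly constant on a small half-disc above \<open>\<theta>\<close>; its interior does the job because
  \<open>\<phi>\<^sub>n\<^sup>- \<le> \<phi>\<^sup>- \<le> \<phi>\<^sup>+ \<le> \<phi>\<^sub>n\<^sup>+\<close>. This treats points on \<open>L\<close> and off \<open>L\<close> alike.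
\<close>

section \<open>Upper semicontinuous envelopes\<close>

text \<open>Only the upper envelope is studied; the lower envelope of \<open>g\<close> is minus the upper envelope of
  \<open>- g\<close>.\<close>

definition usc_envelope :: "'a::metric_space set \<Rightarrow> ('a \<Rightarrow> real) \<Rightarrow> 'a \<Rightarrow> real" where
  "usc_envelope X g x = Lim (at_right 0) (\<lambda>r. SUP y\<in>{y\<in>X. dist y x < r}. g y)"

text \<open>The suprema over balls increase with the radius, so their limit at radius \<open>0\<close> exists and is
  an infimum.\<close>

lemma usc_envelope_eq_INF:
  fixes g :: "'a::metric_space \<Rightarrow> real"
  assumes g: "bdd_above (g ` X)" and x: "x \<in> X"
  defines "S \<equiv> \<lambda>r. SUP y\<in>{y\<in>X. dist y x < r}. g y"
  shows "(S \<longlongrightarrow> (INF r\<in>{0<..}. S r)) (at_right 0)" "usc_envelope X g x = (INF r\<in>{0<..}. S r)"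
    and "bdd_below (S ` {0<..})"
proof -
  have bdd: "bdd_above (g ` {y\<in>X. dist y x < r})" for r
    by (rule bdd_above_mono[OF g]) auto
  have mono: "S r \<le> S s" if "0 < r" "r \<le> s" for r s
    unfolding S_def using that x by (intro cSUP_subset_mono bdd) auto
  have "g x \<le> S r" if "0 < r" for r
    unfolding S_def using that x by (intro cSUP_upper bdd) auto
  then show below: "bdd_below (S ` {0<..})"
    by (intro bdd_belowI2[where m = "g x"]) auto
  show lim: "(S \<longlongrightarrow> (INF r\<in>{0<..}. S r)) (at_right 0)"
  proof (rule order_tendstoI)
    fix e assume "e < (INF r\<in>{0<..}. S r)"
    then have "\<forall>r>0. e < S r"
      using cINF_lower[OF below] by fastforce
    then show "\<forall>\<^sub>F r in at_right 0. e < S r"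
      by (auto simp: eventually_at_right_field intro!: exI[of _ 1])
  next
    fix e assume "(INF r\<in>{0<..}. S r) < e"
    then obtain s where s: "0 < s" "S s < e"
      by (subst (asm) cINF_less_iff[OF _ below]) auto
    moreover have "S r < e" if "0 < r" "r < s" for r
      using mono[of r s] that s by linarith
    ultimately show "\<forall>\<^sub>F r in at_right 0. S r < e"
      unfolding eventually_at_right_field by blast
  qed
  show "usc_envelope X g x = (INF r\<in>{0<..}. S r)"
    unfolding usc_envelope_def S_def[symmetric] by (rule tendsto_Lim[OF _ lim]) simp
qed

lemma usc_envelope_le:
  assumes "bdd_above (g ` X)" "x \<in> X" "0 < r" "\<And>y. y \<in> X \<Longrightarrow> dist y x < r \<Longrightarrow> g y \<le> c"
  shows "usc_envelope X g x \<le> c"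
proof -
  have "usc_envelope X g x \<le> (SUP y\<in>{y\<in>X. dist y x < r}. g y)"
    unfolding usc_envelope_eq_INF(2)[OF assms(1,2)]
    using assms(3) by (intro cINF_lower usc_envelope_eq_INF(3) assms(1,2)) auto
  also have "\<dots> \<le> c"
    using assms by (intro cSUP_least) force+
  finally show ?thesis .
qed

lemma usc_envelope_ge:
  assumes "bdd_above (g ` X)" "x \<in> X"
  shows "g x \<le> usc_envelope X g x"
  unfolding usc_envelope_eq_INF(2)[OF assms]
proof (rule cINF_greatest)
  fix r :: real assume "r \<in> {0<..}"
  then show "g x \<le> (SUP y\<in>{y\<in>X. dist y x < r}. g y)"
    using assms(2) by (intro cSUP_upper bdd_above_mono[OF assms(1)]) auto
qed simp

lemma usc_envelope_less:
  assumes "bdd_above (g ` X)" "x \<in> X" "usc_envelope X g x < c"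
  obtains r where "0 < r" "\<And>y. y \<in> X \<Longrightarrow> dist y x < r \<Longrightarrow> g y < c"
proof -
  obtain r where r: "0 < r" "(SUP y\<in>{y\<in>X. dist y x < r}. g y) < c"
    using assms(3) unfolding usc_envelope_eq_INF(2)[OF assms(1,2)]
    by (subst (asm) cINF_less_iff[OF _ usc_envelope_eq_INF(3)[OF assms(1,2)]]) auto
  have "g y < c" if "y \<in> X" "dist y x < r" for y
  proof -
    have "g y \<le> (SUP y\<in>{y\<in>X. dist y x < r}. g y)"
      using that by (intro cSUP_upper bdd_above_mono[OF assms(1)]) auto
    with r show ?thesis by linarith
  qed
  with r show ?thesis using that by blast
qed

lemma usc_envelope_upper_semicontinuous:
  assumes "bdd_above (g ` X)" "x \<in> X" "usc_envelope X g x < c"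
  shows "\<forall>\<^sub>F y in at x within X. usc_envelope X g y < c"
proof -
  obtain c' where c': "usc_envelope X g x < c'" "c' < c"
    using assms(3) dense by blast
  then obtain r where r: "0 < r" "\<And>y. y \<in> X \<Longrightarrow> dist y x < r \<Longrightarrow> g y < c'"
    using usc_envelope_less[OF assms(1,2)] by blast
  have "usc_envelope X g y < c" if y: "y \<in> X" "dist y x < r" for y
  proof -
    have "dist z x < r" if "dist z y < r - dist y x" for z
      using dist_triangle[of z x y] that by linarith
    then have "usc_envelope X g y \<le> c'"
      using y r(2) by (intro usc_envelope_le[OF assms(1), of _ "r - dist y x"] less_imp_le) auto
    with c' show ?thesis by simp
  qed
  with r(1) show ?thesis
    unfolding eventually_at by blast
qed

text \<open>The envelope of \<open>g\<close> is upper semicontinuous in any case. Near \<open>x\<close> it is also bounded from below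
  by the lower envelope \<open>- usc_envelope X h\<close>, which is lower semicontinuous and has the same value
  at \<open>x\<close>.\<close>

lemma continuous_usc_envelope_if_touching:
  fixes g h :: "'a::metric_space \<Rightarrow> real"
  assumes g: "bdd_above (g ` X)" and h: "bdd_above (h ` X)"
    and le: "\<And>y. y \<in> X \<Longrightarrow> - h y \<le> g y"
    and x: "x \<in> X" and touch: "usc_envelope X g x = - usc_envelope X h x"
  shows "continuous (at x within X) (usc_envelope X g)"
  unfolding continuous_within
proof (rule order_tendstoI)
  fix c assume "c < usc_envelope X g x"
  then have "\<forall>\<^sub>F y in at x within X. usc_envelope X h y < - c"
    using touch by (intro usc_envelope_upper_semicontinuous h x) simp
  moreover have "\<forall>\<^sub>F y in at x within X. y \<in> X"
    by (simp add: eventually_at_topological) blast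
  ultimately show "\<forall>\<^sub>F y in at x within X. c < usc_envelope X g y"
  proof eventually_elim
    case (elim y)
    then show ?case
      using le[of y] usc_envelope_ge[OF g, of y] usc_envelope_ge[OF h, of y] by linarith
  qed
qed (rule usc_envelope_upper_semicontinuous[OF g x])

lemma phi_tilde_plus_eq: "phi_tilde_plus a M f = usc_envelope Theta (phi a f M)"
  by (simp add: fun_eq_iff phi_tilde_plus_def usc_envelope_def)

lemma phi_tilde_minus_eq:
  assumes "bdd_below (phi a f (-M) ` Theta)" "\<theta> \<in> Theta"
  shows "phi_tilde_minus a M f \<theta> = - usc_envelope Theta (\<lambda>\<theta>. - phi a f (-M) \<theta>) \<theta>"
proof -
  let ?g = "\<lambda>\<theta>. - phi a f (-M) \<theta>"
  have *: "bdd_above (?g ` Theta)"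
    using assms(1) by (auto simp: bdd_above_def bdd_below_def) (metis neg_le_iff_le)
  have "(INF y\<in>Y. phi a f (-M) y) = - (SUP y\<in>Y. ?g y)" for Y
    by (simp add: Inf_real_def image_comp comp_def)
  then show ?thesis
    unfolding phi_tilde_minus_def usc_envelope_eq_INF(2)[OF * assms(2)]
    by (simp add: tendsto_Lim tendsto_minus usc_envelope_eq_INF(1)[OF * assms(2)])
qed

section \<open>The inverse Baker transformation\<close>

lemma baker_inv_eq:
  assumes a: "0 < a" "a < 1" and \<theta>: "(\<xi>, x) \<in> Theta"
  shows "baker_inv a (\<xi>, x) =
    (if x < a then (a * \<xi>, x / a) else (a + (1 - a) * \<xi>, (x - a) / (1 - a)))" (is "_ = ?q")
proof -
  have b: "0 \<le> \<xi>" "\<xi> < 1" "0 \<le> x" "x < 1"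
    using \<theta> by (auto simp: Theta_def)
  have "0 \<le> a * \<xi>" "a * \<xi> < a" "0 \<le> (1 - a) * \<xi>" "(1 - a) * \<xi> < 1 - a"
    using a b mult_strict_left_mono[of \<xi> 1 a] mult_strict_left_mono[of \<xi> 1 "1 - a"] by auto
  then have *: "0 \<le> a * \<xi>" "a * \<xi> < 1" "a * \<xi> < a" "0 \<le> a + (1 - a) * \<xi>" "a + (1 - a) * \<xi> < 1"
      "\<not> a + (1 - a) * \<xi> < a"
    using a by linarith+
  have "?q \<in> Theta"
    using a b * by (auto simp: Theta_def divide_less_eq)
  moreover have "baker a ?q = (\<xi>, x)"
    using a * by (auto simp: baker_def tau_def)
  ultimately show ?thesis
    unfolding baker_inv_def
    using bij_betw_baker[OF a] by (intro inv_into_f_eq) (auto simp: bij_betw_def)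
qed

lemma baker_inv_in_Theta: "0 < a \<Longrightarrow> a < 1 \<Longrightarrow> \<theta> \<in> Theta \<Longrightarrow> baker_inv a \<theta> \<in> Theta"
  unfolding baker_inv_def
  using bij_betw_baker[of a] by (metis bij_betw_imp_surj_on inv_into_into)

lemma baker_baker_inv: "0 < a \<Longrightarrow> a < 1 \<Longrightarrow> \<theta> \<in> Theta \<Longrightarrow> baker a (baker_inv a \<theta>) = \<theta>"
  unfolding baker_inv_def
  using bij_betw_baker[of a] by (metis bij_betw_imp_surj_on f_inv_into_f)

text \<open>The neighbourhood filter of \<open>\<theta>\<close> in \<open>Theta\<close>, restricted to heights that are at least the
  height of \<open>\<theta>\<close>.\<close>

definition nhds_right :: "real \<times> real \<Rightarrow> (real \<times> real) filter" where
  "nhds_right \<theta> = inf (nhds \<theta>) (principal {\<theta>'\<in>Theta. snd \<theta> \<le> snd \<theta>'})"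

text \<open>The branch of the inverse is chosen by \<open>x < a\<close> or \<open>a \<le> x\<close>, so it does not change under a small
  increase of \<open>x\<close>; and both branches increase with \<open>x\<close>, so that the image again approaches its
  limit from above. The latter is what allows iteration.\<close>

lemma filterlim_baker_inv_right:
  assumes a: "0 < a" "a < 1" and \<theta>: "\<theta> \<in> Theta"
  shows "filterlim (baker_inv a) (nhds_right (baker_inv a \<theta>)) (nhds_right \<theta>)"
proof -
  obtain \<xi> x where \<theta>_eq: "\<theta> = (\<xi>, x)" by fastforce
  let ?q = "\<lambda>\<theta>'. if x < a then (a * fst \<theta>', snd \<theta>' / a)
                 else (a + (1 - a) * fst \<theta>', (snd \<theta>' - a) / (1 - a))"
  have "\<forall>\<^sub>F \<theta>' in nhds \<theta>. snd \<theta>' < a" if "x < a"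
    using order_tendstoD(2)[OF tendsto_snd[OF filterlim_ident[of "nhds \<theta>"]], of a] that
    by (simp add: \<theta>_eq)
  then have "\<forall>\<^sub>F \<theta>' in nhds \<theta>. x < a \<longrightarrow> snd \<theta>' < a"
    by (cases "x < a") auto
  then have ev: "\<forall>\<^sub>F \<theta>' in nhds_right \<theta>. \<theta>' \<in> Theta \<and> x \<le> snd \<theta>' \<and> baker_inv a \<theta>' = ?q \<theta>'"
    unfolding nhds_right_def eventually_inf_principal
  proof eventually_elim
    case (elim \<theta>')
    then show ?case
      using baker_inv_eq[OF a, of "fst \<theta>'" "snd \<theta>'"] by (auto simp: \<theta>_eq)
  qed
  have q: "baker_inv a \<theta> = ?q \<theta>"
    using baker_inv_eq[OF a \<theta>[unfolded \<theta>_eq]] by (simp add: \<theta>_eq)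
  have lim: "((\<lambda>\<theta>'. \<theta>') \<longlongrightarrow> \<theta>) (nhds_right \<theta>)"
    unfolding nhds_right_def by (rule filterlim_mono[OF filterlim_ident]) auto
  have "(?q \<longlongrightarrow> ?q \<theta>) (nhds_right \<theta>)"
    using a by (auto intro!: tendsto_intros tendsto_fst[OF lim] tendsto_snd[OF lim])
  then have "(baker_inv a \<longlongrightarrow> baker_inv a \<theta>) (nhds_right \<theta>)"
    unfolding q by (rule Lim_transform_eventually) (use ev in eventually_elim, simp)
  moreover have "\<forall>\<^sub>F \<theta>' in nhds_right \<theta>. baker_inv a \<theta>' \<in> {\<theta>'\<in>Theta. snd (baker_inv a \<theta>) \<le> snd \<theta>'}"
    using ev
  proof eventually_elim
    case (elim \<theta>')
    then show ?case
      using baker_inv_in_Theta[OF a, of \<theta>'] a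
      by (auto simp: baker_inv_eq[OF a \<theta>[unfolded \<theta>_eq]] \<theta>_eq divide_right_mono)
  qed
  ultimately show ?thesis
    unfolding nhds_right_def[of "baker_inv a \<theta>"] by (simp add: filterlim_inf filterlim_principal)
qed

section \<open>Pullbacks in a skew product with contracted fibres\<close>

lemma torus_dist_le_dist: "torus_dist p q \<le> dist p q"
proof -
  have "q + (0, 0) \<in> (+) q ` (\<int> \<times> \<int>)"
    by (intro imageI) auto
  then show ?thesis
    unfolding torus_dist_def by (intro infdist_le) (simp add: zero_prod_def[symmetric])
qed

text \<open>What the argument retains of the standing hypotheses: Lipschitz bounds for the fibre maps in
  both variables, and contraction of the horizontal fibres towards the section \<open>\<sigma>\<close>. The distance of
  \<open>\<theta>\<close> to the section is absorbed into the constant \<open>D\<close>.\<close>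

locale contracted_skew_product =
  fixes a M \<Lambda> K D \<alpha> :: real and f :: "real \<times> real \<Rightarrow> real \<Rightarrow> real"
    and \<sigma> :: "real \<Rightarrow> real \<times> real"
  assumes a: "0 < a" "a < 1" and M: "0 < M"
    and fibre_range: "\<And>\<theta> y. \<theta> \<in> Theta \<Longrightarrow> y \<in> {-M..M} \<Longrightarrow> f \<theta> y \<in> {-M..M}"
    and fibre_mono: "\<And>\<theta>. \<theta> \<in> Theta \<Longrightarrow> strict_mono_on {-M..M} (f \<theta>)"
    and \<Lambda>: "0 \<le> \<Lambda>"
    and lipschitz_fibre: "\<And>\<theta> y z. \<theta> \<in> Theta \<Longrightarrow> y \<in> {-M..M} \<Longrightarrow> z \<in> {-M..M} \<Longrightarrow>
      \<bar>f \<theta> y - f \<theta> z\<bar> \<le> \<Lambda> * \<bar>y - z\<bar>"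
    and K: "0 \<le> K"
    and lipschitz_base: "\<And>\<theta> \<theta>' y. \<theta> \<in> Theta \<Longrightarrow> \<theta>' \<in> Theta \<Longrightarrow> y \<in> {-M..M} \<Longrightarrow>
      \<bar>f \<theta> y - f \<theta>' y\<bar> \<le> K * torus_dist \<theta> \<theta>'"
    and \<alpha>: "0 < \<alpha>" "\<alpha> * \<Lambda> < 1"
    and D: "0 \<le> D"
    and \<sigma>: "\<And>x. x \<in> {0..<1} \<Longrightarrow> \<sigma> x \<in> Theta" "\<And>x. x \<in> {0..<1} \<Longrightarrow> snd (\<sigma> x) = x"
    and contraction: "\<And>\<theta> n. \<theta> \<in> Theta \<Longrightarrow> 0 < n \<Longrightarrow>
      torus_dist ((baker_inv a ^^ n) \<theta>) ((baker_inv a ^^ n) (\<sigma> (snd \<theta>))) \<le> D * \<alpha> ^ n"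
begin

abbreviation Sinv where "Sinv \<equiv> baker_inv a"

definition pullback :: "nat \<Rightarrow> real \<times> real \<Rightarrow> real \<Rightarrow> real" where
  "pullback n \<theta> = fibre_iter a f n ((Sinv ^^ n) \<theta>)"

lemma Sinv_Theta: "\<theta> \<in> Theta \<Longrightarrow> Sinv \<theta> \<in> Theta"
  using baker_inv_in_Theta a by blast

lemma Sinv_pow_Theta: "\<theta> \<in> Theta \<Longrightarrow> (Sinv ^^ n) \<theta> \<in> Theta"
  by (induction n) (auto intro: Sinv_Theta)

lemma baker_pow_Sinv_pow: "\<theta> \<in> Theta \<Longrightarrow> (baker a ^^ n) ((Sinv ^^ n) \<theta>) = \<theta>"
proof (induction n)
  case (Suc n)
  have "(baker a ^^ Suc n) ((Sinv ^^ Suc n) \<theta>) = (baker a ^^ n) (baker a (Sinv ((Sinv ^^ n) \<theta>)))"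
    by (simp only: funpow_Suc_right[of n "baker a"] funpow.simps(2)[of n Sinv] comp_apply)
  also have "\<dots> = \<theta>"
    using Suc baker_baker_inv[OF a Sinv_pow_Theta] by simp
  finally show ?case .
qed simp

lemma pullback_0 [simp]: "pullback 0 \<theta> y = y"
  by (simp add: pullback_def)

text \<open>Peeling off the last map of the composition instead of the first one leaves a pullback over
  \<open>S\<^sup>-\<^sup>1 \<theta>\<close>; all later inductions on \<open>n\<close> run along this recursion.\<close>

lemma pullback_Suc:
  assumes "\<theta> \<in> Theta"
  shows "pullback (Suc n) \<theta> y = f (Sinv \<theta>) (pullback n (Sinv \<theta>) y)"
  using baker_pow_Sinv_pow[OF Sinv_Theta[OF assms], of n]
  by (simp add: pullback_def funpow_swap1)

lemma pullback_range:
  "\<theta> \<in> Theta \<Longrightarrow> y \<in> {-M..M} \<Longrightarrow> pullback n \<theta> y \<in> {-M..M}"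
proof (induction n arbitrary: \<theta>)
  case (Suc n)
  then show ?case
    using fibre_range[OF Sinv_Theta Suc.IH[OF Sinv_Theta]] by (simp only: pullback_Suc)
qed simp

lemma fibre_le:
  "\<theta> \<in> Theta \<Longrightarrow> y \<in> {-M..M} \<Longrightarrow> z \<in> {-M..M} \<Longrightarrow> y \<le> z \<Longrightarrow> f \<theta> y \<le> f \<theta> z"
  using fibre_mono strict_mono_on_leD by blast

lemma pm_M_in: "M \<in> {-M..M}" "-M \<in> {-M..M}"
  using M by auto

lemma pullback_top_decreasing: "\<theta> \<in> Theta \<Longrightarrow> pullback (Suc n) \<theta> M \<le> pullback n \<theta> M"
proof (induction n arbitrary: \<theta>)
  case 0
  then show ?case using pullback_range[OF 0 pm_M_in(1), of 1] by simp
next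
  case (Suc n)
  have t: "Sinv \<theta> \<in> Theta" using Suc.prems Sinv_Theta by blast
  show ?case
    using fibre_le[OF t pullback_range[OF t pm_M_in(1), of "Suc n"] pullback_range[OF t pm_M_in(1), of n] Suc.IH[OF t]]
    unfolding pullback_Suc[OF Suc.prems] .
qed

lemma pullback_bottom_increasing: "\<theta> \<in> Theta \<Longrightarrow> pullback n \<theta> (-M) \<le> pullback (Suc n) \<theta> (-M)"
proof (induction n arbitrary: \<theta>)
  case 0
  then show ?case using pullback_range[OF 0 pm_M_in(2), of 1] by simp
next
  case (Suc n)
  have t: "Sinv \<theta> \<in> Theta" using Suc.prems Sinv_Theta by blast
  show ?case
    using fibre_le[OF t pullback_range[OF t pm_M_in(2), of n] pullback_range[OF t pm_M_in(2), of "Suc n"] Suc.IH[OF t]]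
    unfolding pullback_Suc[OF Suc.prems] .
qed

lemma pullback_top_bottom: "\<theta> \<in> Theta \<Longrightarrow> pullback n \<theta> (-M) \<le> pullback n \<theta> M"
proof (induction n arbitrary: \<theta>)
  case 0
  then show ?case using M by simp
next
  case (Suc n)
  have t: "Sinv \<theta> \<in> Theta" using Suc.prems Sinv_Theta by blast
  show ?case
    using fibre_le[OF t pullback_range[OF t pm_M_in(2), of n] pullback_range[OF t pm_M_in(1), of n] Suc.IH[OF t]]
    unfolding pullback_Suc[OF Suc.prems] .
qed

abbreviation phi_top where "phi_top \<equiv> phi a f M"
abbreviation phi_bot where "phi_bot \<equiv> phi a f (-M)"

lemma phi_top_limit:
  assumes \<theta>: "\<theta> \<in> Theta"
  shows "(\<lambda>n. pullback n \<theta> M) \<longlonglongrightarrow> phi_top \<theta>" "phi_top \<theta> \<le> pullback n \<theta> M"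
proof -
  have dec: "decseq (\<lambda>n. pullback n \<theta> M)"
    using pullback_top_decreasing[OF \<theta>] by (intro decseq_SucI)
  moreover have "\<And>n. -M \<le> pullback n \<theta> M"
    using pullback_range[OF \<theta> pm_M_in(1)] by simp
  ultimately have "convergent (\<lambda>n. pullback n \<theta> M)"
    by (metis decseq_convergent convergentI)
  then show lim: "(\<lambda>n. pullback n \<theta> M) \<longlonglongrightarrow> phi_top \<theta>"
    by (simp add: convergent_LIMSEQ_iff phi_def pullback_def)
  show "phi_top \<theta> \<le> pullback n \<theta> M"
    using decseq_ge[OF dec lim] .
qed

lemma phi_bot_limit:
  assumes \<theta>: "\<theta> \<in> Theta"
  shows "(\<lambda>n. pullback n \<theta> (-M)) \<longlonglongrightarrow> phi_bot \<theta>" "pullback n \<theta> (-M) \<le> phi_bot \<theta>"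
proof -
  have inc: "incseq (\<lambda>n. pullback n \<theta> (-M))"
    using pullback_bottom_increasing[OF \<theta>] by (intro incseq_SucI)
  moreover have "\<And>n. pullback n \<theta> (-M) \<le> M"
    using pullback_range[OF \<theta> pm_M_in(2)] by simp
  ultimately have "convergent (\<lambda>n. pullback n \<theta> (-M))"
    by (metis incseq_convergent convergentI)
  then show lim: "(\<lambda>n. pullback n \<theta> (-M)) \<longlonglongrightarrow> phi_bot \<theta>"
    by (simp add: convergent_LIMSEQ_iff phi_def pullback_def)
  show "pullback n \<theta> (-M) \<le> phi_bot \<theta>"
    using incseq_le[OF inc lim] .
qed

lemma phi_bot_le_top: "\<theta> \<in> Theta \<Longrightarrow> phi_bot \<theta> \<le> phi_top \<theta>"
  using LIMSEQ_le[OF phi_bot_limit(1) phi_top_limit(1)] pullback_top_bottom by blast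

lemma phi_range:
  assumes "\<theta> \<in> Theta"
  shows "phi_top \<theta> \<in> {-M..M}" "phi_bot \<theta> \<in> {-M..M}"
  using phi_top_limit(2)[OF assms, of 0] phi_bot_limit(2)[OF assms, of 0] phi_bot_le_top[OF assms]
  by auto

lemma fibre_limit:
  assumes \<theta>: "\<theta> \<in> Theta" and u: "\<And>n::nat. u n \<in> {-M..M}" "u \<longlonglongrightarrow> l" "l \<in> {-M..M}"
  shows "(\<lambda>n. f \<theta> (u n)) \<longlonglongrightarrow> f \<theta> l"
proof -
  have "(\<lambda>n. \<Lambda> * \<bar>u n - l\<bar>) \<longlonglongrightarrow> \<Lambda> * \<bar>l - l\<bar>"
    by (intro tendsto_intros u)
  then have lim: "(\<lambda>n. \<Lambda> * \<bar>u n - l\<bar>) \<longlonglongrightarrow> 0" by simp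
  have "(\<lambda>n. f \<theta> (u n) - f \<theta> l) \<longlonglongrightarrow> 0"
    by (rule Lim_null_comparison[OF _ lim]) (simp add: lipschitz_fibre[OF \<theta> u(1) u(3)] del: atLeastAtMost_iff)
  then show ?thesis
    by (simp add: LIM_zero_iff)
qed

lemma phi_invariant:
  assumes \<theta>: "\<theta> \<in> Theta"
  shows "phi_top \<theta> = f (Sinv \<theta>) (phi_top (Sinv \<theta>))" "phi_bot \<theta> = f (Sinv \<theta>) (phi_bot (Sinv \<theta>))"
proof -
  note t = Sinv_Theta[OF \<theta>]
  have "(\<lambda>n. pullback (Suc n) \<theta> M) \<longlonglongrightarrow> f (Sinv \<theta>) (phi_top (Sinv \<theta>))"
    "(\<lambda>n. pullback (Suc n) \<theta> (-M)) \<longlonglongrightarrow> f (Sinv \<theta>) (phi_bot (Sinv \<theta>))"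
    unfolding pullback_Suc[OF \<theta>]
    by (intro fibre_limit t pullback_range pm_M_in phi_top_limit phi_bot_limit phi_range)+
  then show "phi_top \<theta> = f (Sinv \<theta>) (phi_top (Sinv \<theta>))" "phi_bot \<theta> = f (Sinv \<theta>) (phi_bot (Sinv \<theta>))"
    using LIMSEQ_unique LIMSEQ_Suc phi_top_limit(1)[OF \<theta>] phi_bot_limit(1)[OF \<theta>] by blast+
qed

section \<open>The pinched set\<close>

abbreviation P where "P \<equiv> P_set a M f"

lemma P_Sinv_iff:
  assumes \<theta>: "\<theta> \<in> Theta"
  shows "Sinv \<theta> \<in> P \<longleftrightarrow> \<theta> \<in> P"
proof -
  note t = Sinv_Theta[OF \<theta>]
  have "inj_on (f (Sinv \<theta>)) {-M..M}"
    by (rule strict_mono_on_imp_inj_on[OF fibre_mono[OF t]])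
  then show ?thesis
    unfolding P_set_def using \<theta> t phi_range[OF t] phi_invariant[OF \<theta>] by (auto simp: inj_on_eq_iff)
qed

lemma gap_le_gap_Sinv_pow:
  assumes \<theta>: "\<theta> \<in> Theta"
  shows "phi_top \<theta> - phi_bot \<theta> \<le> \<Lambda> ^ m * (phi_top ((Sinv ^^ m) \<theta>) - phi_bot ((Sinv ^^ m) \<theta>))"
proof (induction m)
  case (Suc m)
  define \<theta>' where "\<theta>' = (Sinv ^^ m) \<theta>"
  have \<theta>': "\<theta>' \<in> Theta" using Sinv_pow_Theta[OF \<theta>] by (simp add: \<theta>'_def)
  note t = Sinv_Theta[OF \<theta>']
  have "phi_top \<theta>' - phi_bot \<theta>' \<le> \<Lambda> * (phi_top (Sinv \<theta>') - phi_bot (Sinv \<theta>'))"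
    using lipschitz_fibre[OF t phi_range[OF t]] phi_bot_le_top[OF t] phi_invariant[OF \<theta>'] by simp
  then have "\<Lambda> ^ m * (phi_top \<theta>' - phi_bot \<theta>') \<le> \<Lambda> ^ m * (\<Lambda> * (phi_top (Sinv \<theta>') - phi_bot (Sinv \<theta>')))"
    using \<Lambda> by (intro mult_left_mono) auto
  with Suc show ?case
    by (simp add: \<theta>'_def algebra_simps)
qed simp

text \<open>The base points are at distance at most \<open>D \<alpha>\<^sup>m\<^sup>+\<^sup>1\<close> one step further back, so an error bound \<open>E \<alpha>\<^sup>m\<close>
  survives the recursion if \<open>\<Lambda> E \<alpha> + K D \<alpha> \<le> E\<close>. The constant below is the solution of the
  corresponding equation, which is nonnegative because \<open>\<alpha>\<Lambda> < 1\<close>.\<close>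

lemma pullback_fibre_distance:
  assumes \<theta>: "\<theta> \<in> Theta" and y: "y \<in> {-M..M}"
  shows "\<bar>pullback n ((Sinv ^^ m) \<theta>) y - pullback n ((Sinv ^^ m) (\<sigma> (snd \<theta>))) y\<bar>
    \<le> K * D * \<alpha> / (1 - \<alpha> * \<Lambda>) * \<alpha> ^ m"
proof (induction n arbitrary: m)
  case 0
  have "0 \<le> K * D * \<alpha> / (1 - \<alpha> * \<Lambda>) * \<alpha> ^ m"
    using K D \<alpha> by (intro mult_nonneg_nonneg divide_nonneg_nonneg) auto
  then show ?case by simp
next
  case (Suc n)
  define E where "E = K * D * \<alpha> / (1 - \<alpha> * \<Lambda>)"
  define p where "p = (Sinv ^^ Suc m) \<theta>"
  define q where "q = (Sinv ^^ Suc m) (\<sigma> (snd \<theta>))"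
  have s: "\<sigma> (snd \<theta>) \<in> Theta"
    using \<theta> \<sigma>(1) by (auto simp: Theta_def)
  have pq: "p \<in> Theta" "q \<in> Theta"
    unfolding p_def q_def using Sinv_pow_Theta \<theta> s by blast+
  note r = pullback_range[OF pq(1) y, of n] pullback_range[OF pq(2) y, of n]
  have IH: "\<bar>pullback n p y - pullback n q y\<bar> \<le> E * \<alpha> ^ Suc m"
    using Suc.IH[of "Suc m"] by (simp only: p_def q_def E_def)
  have "\<bar>f p (pullback n p y) - f q (pullback n q y)\<bar>
      \<le> \<bar>f p (pullback n p y) - f p (pullback n q y)\<bar> + \<bar>f p (pullback n q y) - f q (pullback n q y)\<bar>"
    by linarith
  also have "\<dots> \<le> \<Lambda> * \<bar>pullback n p y - pullback n q y\<bar> + K * torus_dist p q"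
    by (intro add_mono lipschitz_fibre lipschitz_base pq r)
  also have "\<dots> \<le> \<Lambda> * (E * \<alpha> ^ Suc m) + K * (D * \<alpha> ^ Suc m)"
    using IH contraction[OF \<theta>, of "Suc m"] \<Lambda> K
    by (intro add_mono mult_left_mono) (auto simp: p_def q_def)
  also have "\<dots> = (\<alpha> * \<Lambda> * E + K * D * \<alpha>) * \<alpha> ^ m"
    by (simp add: algebra_simps)
  also have "\<alpha> * \<Lambda> * E + K * D * \<alpha> = E"
    using \<alpha> by (simp add: E_def field_simps)
  finally show ?case
    using pullback_Suc[OF Sinv_pow_Theta[OF \<theta>]] pullback_Suc[OF Sinv_pow_Theta[OF s]]
    by (simp add: p_def q_def E_def)
qed

lemma phi_fibre_distance:
  assumes \<theta>: "\<theta> \<in> Theta"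
  defines "E \<equiv> K * D * \<alpha> / (1 - \<alpha> * \<Lambda>)"
  shows "\<bar>phi_top ((Sinv ^^ m) \<theta>) - phi_top ((Sinv ^^ m) (\<sigma> (snd \<theta>)))\<bar> \<le> E * \<alpha> ^ m"
    and "\<bar>phi_bot ((Sinv ^^ m) \<theta>) - phi_bot ((Sinv ^^ m) (\<sigma> (snd \<theta>)))\<bar> \<le> E * \<alpha> ^ m"
proof -
  have s: "\<sigma> (snd \<theta>) \<in> Theta"
    using \<theta> \<sigma>(1) by (auto simp: Theta_def)
  note t = Sinv_pow_Theta[OF \<theta>, of m] Sinv_pow_Theta[OF s, of m]
  note b = pullback_fibre_distance[OF \<theta>, folded E_def]
  show "\<bar>phi_top ((Sinv ^^ m) \<theta>) - phi_top ((Sinv ^^ m) (\<sigma> (snd \<theta>)))\<bar> \<le> E * \<alpha> ^ m"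
    by (rule LIMSEQ_le_const2[OF tendsto_rabs[OF tendsto_diff[OF phi_top_limit(1)[OF t(1)] phi_top_limit(1)[OF t(2)]]]])
       (use b[OF pm_M_in(1)] in blast)
  show "\<bar>phi_bot ((Sinv ^^ m) \<theta>) - phi_bot ((Sinv ^^ m) (\<sigma> (snd \<theta>)))\<bar> \<le> E * \<alpha> ^ m"
    by (rule LIMSEQ_le_const2[OF tendsto_rabs[OF tendsto_diff[OF phi_bot_limit(1)[OF t(1)] phi_bot_limit(1)[OF t(2)]]]])
       (use b[OF pm_M_in(2)] in blast)
qed

lemma P_Sinv_pow: "\<theta> \<in> P \<Longrightarrow> (Sinv ^^ m) \<theta> \<in> P"
proof (induction m)
  case (Suc m)
  then show ?case
    using P_Sinv_iff[of "(Sinv ^^ m) \<theta>"] by (simp add: P_set_def)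
qed simp

text \<open>The error over the \<open>m\<close>-th preimage contracts at rate \<open>\<alpha>\<close>, and pushing it forward to \<open>\<theta>\<close> costs
  at most \<open>\<Lambda>\<^sup>m\<close>.\<close>

lemma pinched_if_shadowed:
  assumes \<theta>: "\<theta> \<in> Theta" and \<theta>': "\<theta>' \<in> P"
    and top: "\<And>m. \<bar>phi_top ((Sinv ^^ m) \<theta>) - phi_top ((Sinv ^^ m) \<theta>')\<bar> \<le> E * \<alpha> ^ m"
    and bot: "\<And>m. \<bar>phi_bot ((Sinv ^^ m) \<theta>) - phi_bot ((Sinv ^^ m) \<theta>')\<bar> \<le> E * \<alpha> ^ m"
  shows "\<theta> \<in> P"
proof -
  have "phi_top \<theta> - phi_bot \<theta> \<le> 2 * E * (\<alpha> * \<Lambda>) ^ m" for m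
  proof -
    have "phi_top ((Sinv ^^ m) \<theta>) - phi_bot ((Sinv ^^ m) \<theta>) \<le> 2 * E * \<alpha> ^ m"
      using top[of m] bot[of m] P_Sinv_pow[OF \<theta>', of m] by (auto simp: P_set_def)
    then have "\<Lambda> ^ m * (phi_top ((Sinv ^^ m) \<theta>) - phi_bot ((Sinv ^^ m) \<theta>)) \<le> \<Lambda> ^ m * (2 * E * \<alpha> ^ m)"
      using \<Lambda> by (intro mult_left_mono) auto
    then show ?thesis
      using gap_le_gap_Sinv_pow[OF \<theta>, of m] by (simp add: power_mult_distrib algebra_simps)
  qed
  moreover have "(\<lambda>m. 2 * E * (\<alpha> * \<Lambda>) ^ m) \<longlonglongrightarrow> 2 * E * 0"
    using \<alpha> \<Lambda> by (intro tendsto_intros LIMSEQ_power_zero) auto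
  ultimately have "phi_top \<theta> - phi_bot \<theta> \<le> 0"
    using LIMSEQ_le_const by fastforce
  with phi_bot_le_top[OF \<theta>] \<theta> show ?thesis
    by (simp add: P_set_def)
qed

text \<open>The contraction is available only towards the section, so pinching is carried over in two steps,
  from \<open>\<theta>\<close> to the point of the section on its fibre and from there to \<open>\<theta>'\<close>.\<close>

lemma P_fibre_saturated:
  assumes "\<theta> \<in> P" "\<theta>' \<in> Theta" "snd \<theta>' = snd \<theta>"
  shows "\<theta>' \<in> P"
proof -
  have \<theta>: "\<theta> \<in> Theta" using assms(1) by (simp add: P_set_def)
  then have s: "\<sigma> (snd \<theta>) \<in> Theta"
    using \<sigma>(1) by (auto simp: Theta_def)
  have "\<sigma> (snd \<theta>) \<in> P"
    by (rule pinched_if_shadowed[OF s assms(1)]; subst abs_minus_commute) (rule phi_fibre_distance[OF \<theta>])+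
  then show ?thesis
    unfolding assms(3)[symmetric]
    by (rule pinched_if_shadowed[OF assms(2)]) (rule phi_fibre_distance[OF assms(2)])+
qed

text \<open>One step pulls the claim for \<open>\<tau>(x)\<close> back by the inverse branch of \<open>\<tau>\<close> belonging to \<open>x\<close>. This
  branch contracts by \<open>a\<close> or \<open>1 - a\<close>, and it maps heights of pinched fibres to heights of pinched
  fibres by invariance under \<open>S\<close>.\<close>

lemma P_dense_heights:
  assumes "\<theta>\<^sub>0 \<in> P" "x \<in> {0..<1}"
  shows "\<exists>y\<in>{0..<1}. \<bar>y - x\<bar> \<le> max a (1 - a) ^ k \<and> (\<forall>\<xi>\<in>{0..<1}. (\<xi>, y) \<in> P)"
  using assms(2)
proof (induction k arbitrary: x)
  case 0
  have "snd \<theta>\<^sub>0 \<in> {0..<1}" using assms(1) by (auto simp: P_set_def Theta_def)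
  moreover have "(\<xi>, snd \<theta>\<^sub>0) \<in> P" if "\<xi> \<in> {0..<1}" for \<xi>
    using that \<open>snd \<theta>\<^sub>0 \<in> {0..<1}\<close> by (intro P_fibre_saturated[OF assms(1)]) (auto simp: Theta_def)
  ultimately show ?case
    using 0 by (intro bexI[of _ "snd \<theta>\<^sub>0"]) auto
next
  case (Suc k)
  \<comment> \<open>The inverse branch is \<open>t \<mapsto> b + c t\<close>, and \<open>z = \<tau>(x)\<close>.\<close>
  define c where "c = (if x < a then a else 1 - a)"
  define b where "b = (if x < a then 0 else a)"
  define z where "z = (x - b) / c"
  have c: "0 < c" "c \<le> max a (1 - a)" "b \<ge> 0" "b + c \<le> 1"
    using a by (auto simp: c_def b_def)
  have x: "x = b + c * z"
    using c by (simp add: z_def)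
  have "z \<in> {0..<1}"
    using Suc.prems a by (auto simp: z_def c_def b_def)
  from Suc.IH[OF this] obtain y where y: "0 \<le> y" "y < 1" "\<bar>y - z\<bar> \<le> max a (1 - a) ^ k"
    "\<And>\<xi>. \<xi> \<in> {0..<1} \<Longrightarrow> (\<xi>, y) \<in> P" by auto
  have cy: "0 \<le> c * y" "c * y < c"
    using c y mult_strict_left_mono[of y 1 c] by auto
  have "\<bar>b + c * y - x\<bar> = c * \<bar>y - z\<bar>"
    using c by (simp add: x abs_mult flip: right_diff_distrib)
  also have "\<dots> \<le> max a (1 - a) * max a (1 - a) ^ k"
    using c y a by (intro mult_mono) auto
  finally have "\<bar>b + c * y - x\<bar> \<le> max a (1 - a) ^ Suc k" by simp
  moreover have "(\<xi>, b + c * y) \<in> P" if \<xi>: "\<xi> \<in> {0..<1}" for \<xi>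
  proof -
    have t: "(\<xi>, b + c * y) \<in> Theta"
      using \<xi> cy c(3,4) by (simp add: Theta_def)
    have "snd (Sinv (\<xi>, b + c * y)) = y"
      using baker_inv_eq[OF a t] a cy by (auto simp: b_def c_def split: if_splits)
    moreover have "fst (Sinv (\<xi>, b + c * y)) \<in> {0..<1}"
      using Sinv_Theta[OF t] by (auto simp: Theta_def)
    ultimately have "Sinv (\<xi>, b + c * y) \<in> P"
      using y(4) by (metis prod.collapse)
    then show ?thesis
      using P_Sinv_iff[OF t] by simp
  qed
  ultimately show ?case
    using c cy by (intro bexI[of _ "b + c * y"]) auto
qed

lemma P_dense:
  assumes "P \<noteq> {}" "\<theta> \<in> Theta" "0 < r"
  obtains \<theta>' where "\<theta>' \<in> P" "dist \<theta>' \<theta> < r"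
proof -
  obtain \<theta>\<^sub>0 where "\<theta>\<^sub>0 \<in> P" using assms(1) by blast
  obtain \<xi> x where \<theta>: "\<theta> = (\<xi>, x)" "\<xi> \<in> {0..<1}" "x \<in> {0..<1}"
    using assms(2) by (auto simp: Theta_def)
  obtain k where k: "max a (1 - a) ^ k < r"
    using real_arch_pow_inv[of r "max a (1 - a)"] a assms(3) by auto
  obtain y where "\<bar>y - x\<bar> \<le> max a (1 - a) ^ k" "(\<xi>, y) \<in> P"
    using P_dense_heights[OF \<open>\<theta>\<^sub>0 \<in> P\<close> \<theta>(3), of k] \<theta>(2) by blast
  then show ?thesis
    using k by (intro that[of "(\<xi>, y)"]) (auto simp: \<theta> dist_Pair_Pair dist_real_def)
qed

section \<open>Nearly pinched open sets\<close>

lemma pullback_right_continuous: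
  assumes "\<theta> \<in> Theta" "y \<in> {-M..M}"
  shows "((\<lambda>\<theta>'. pullback n \<theta>' y) \<longlongrightarrow> pullback n \<theta> y) (nhds_right \<theta>)"
  using assms(1)
proof (induction n arbitrary: \<theta>)
  case (Suc n)
  note t = Sinv_Theta[OF Suc.prems]
  have S: "filterlim Sinv (nhds_right (Sinv \<theta>)) (nhds_right \<theta>)"
    by (rule filterlim_baker_inv_right[OF a Suc.prems])
  then have S': "(Sinv \<longlongrightarrow> Sinv \<theta>) (nhds_right \<theta>)"
    by (rule filterlim_mono) (auto simp: nhds_right_def)
  have IH: "((\<lambda>\<theta>'. pullback n (Sinv \<theta>') y) \<longlongrightarrow> pullback n (Sinv \<theta>) y) (nhds_right \<theta>)"
    using filterlim_compose[OF Suc.IH[OF t] S] .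
  let ?b = "\<lambda>\<theta>'. K * dist (Sinv \<theta>') (Sinv \<theta>) + \<Lambda> * \<bar>pullback n (Sinv \<theta>') y - pullback n (Sinv \<theta>) y\<bar>"
  have "(?b \<longlongrightarrow> K * dist (Sinv \<theta>) (Sinv \<theta>) + \<Lambda> * \<bar>pullback n (Sinv \<theta>) y - pullback n (Sinv \<theta>) y\<bar>)
      (nhds_right \<theta>)"
    by (intro tendsto_intros S' IH)
  then have lim: "(?b \<longlongrightarrow> 0) (nhds_right \<theta>)" by simp
  have "\<forall>\<^sub>F \<theta>' in nhds_right \<theta>. \<theta>' \<in> Theta"
    unfolding nhds_right_def eventually_inf_principal by simp
  then have "\<forall>\<^sub>F \<theta>' in nhds_right \<theta>. norm (pullback (Suc n) \<theta>' y - pullback (Suc n) \<theta> y) \<le> ?b \<theta>'"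
  proof eventually_elim
    case (elim \<theta>')
    note t' = Sinv_Theta[OF elim]
    let ?p' = "pullback n (Sinv \<theta>') y" and ?p = "pullback n (Sinv \<theta>) y"
    have "\<bar>f (Sinv \<theta>') ?p' - f (Sinv \<theta>) ?p'\<bar> \<le> K * torus_dist (Sinv \<theta>') (Sinv \<theta>)"
      by (intro lipschitz_base t t' pullback_range assms(2))
    also have "\<dots> \<le> K * dist (Sinv \<theta>') (Sinv \<theta>)"
      by (intro mult_left_mono torus_dist_le_dist K)
    finally have "\<bar>f (Sinv \<theta>') ?p' - f (Sinv \<theta>) ?p'\<bar> \<le> K * dist (Sinv \<theta>') (Sinv \<theta>)" .
    moreover have "\<bar>f (Sinv \<theta>) ?p' - f (Sinv \<theta>) ?p\<bar> \<le> \<Lambda> * \<bar>?p' - ?p\<bar>"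
      by (intro lipschitz_fibre t t' pullback_range assms(2))
    ultimately show ?case
      unfolding pullback_Suc[OF elim] pullback_Suc[OF Suc.prems] by simp
  qed
  then show ?case
    by (rule LIM_zero_cancel[OF Lim_null_comparison[OF _ lim]])
qed simp

text \<open>The conclusion confines \<open>\<phi>\<^sup>+\<close> and \<open>\<phi>\<^sup>-\<close> to one interval \<open>[l, u]\<close> for the whole ball, since a
  pointwise bound on \<open>\<phi>\<^sup>+ - \<phi>\<^sup>-\<close> would not bound the difference of the envelopes. Continuity of the
  pullbacks is known only above \<open>\<theta>\<close>, hence the centre is moved up by the radius.\<close>

lemma nearly_pinched_ball_near_P:
  assumes \<theta>: "\<theta> \<in> P" and \<epsilon>: "0 < \<epsilon>" and r: "0 < r"
  obtains \<theta>' s u l where "\<theta>' \<in> Theta" "dist \<theta>' \<theta> < r" "0 < s" "u - l \<le> \<epsilon>"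
    "\<And>\<theta>''. \<theta>'' \<in> Theta \<Longrightarrow> dist \<theta>'' \<theta>' < s \<Longrightarrow> phi_top \<theta>'' \<le> u \<and> l \<le> phi_bot \<theta>''"
proof -
  have \<theta>T: "\<theta> \<in> Theta" and pinch: "phi_top \<theta> = phi_bot \<theta>"
    using \<theta> by (auto simp: P_set_def)
  have "(\<lambda>n. pullback n \<theta> M - pullback n \<theta> (-M)) \<longlonglongrightarrow> phi_top \<theta> - phi_bot \<theta>"
    by (intro tendsto_intros phi_top_limit phi_bot_limit \<theta>T)
  then have "\<forall>\<^sub>F n in sequentially. pullback n \<theta> M - pullback n \<theta> (-M) < \<epsilon> / 3"
    using pinch \<epsilon> by (intro order_tendstoD(2)) auto
  then obtain n where n: "pullback n \<theta> M - pullback n \<theta> (-M) < \<epsilon> / 3"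
    by (auto simp: eventually_sequentially)
  define u where "u = pullback n \<theta> M + \<epsilon> / 3"
  define l where "l = pullback n \<theta> (-M) - \<epsilon> / 3"
  have "\<forall>\<^sub>F \<theta>' in nhds_right \<theta>. pullback n \<theta>' M < u" "\<forall>\<^sub>F \<theta>' in nhds_right \<theta>. l < pullback n \<theta>' (-M)"
    using \<epsilon> order_tendstoD(2)[OF pullback_right_continuous[OF \<theta>T pm_M_in(1)], of n u]
      order_tendstoD(1)[OF pullback_right_continuous[OF \<theta>T pm_M_in(2)], of l n]
    by (auto simp: u_def l_def)
  then have "\<forall>\<^sub>F \<theta>' in nhds_right \<theta>. pullback n \<theta>' M < u \<and> l < pullback n \<theta>' (-M)"
    by (rule eventually_conj)
  then obtain d where d: "0 < d" "\<And>\<theta>'. dist \<theta>' \<theta> < d \<Longrightarrow> \<theta>' \<in> Theta \<Longrightarrow> snd \<theta> \<le> snd \<theta>' \<Longrightarrow>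
      pullback n \<theta>' M < u \<and> l < pullback n \<theta>' (-M)"
    unfolding nhds_right_def eventually_inf_principal eventually_nhds_metric by auto
  obtain \<xi> x where \<theta>_eq: "\<theta> = (\<xi>, x)" "\<xi> \<in> {0..<1}" "x \<in> {0..<1}"
    using \<theta>T by (auto simp: Theta_def)
  \<comment> \<open>The ball of radius \<open>s\<close> about the shifted point stays above \<open>\<theta>\<close> and within distance \<open>2 s \<le> d\<close> of it.\<close>
  define s where "s = min (min d r) (1 - x) / 2"
  have s: "0 < s" "2 * s \<le> d" "s < r" "s < 1 - x"
    using d r \<theta>_eq by (auto simp: s_def min_def)
  define \<theta>' where "\<theta>' = (\<xi>, x + s)"
  have "\<theta>' \<in> Theta" and dist: "dist \<theta>' \<theta> = s"
    using \<theta>_eq s by (auto simp: \<theta>'_def Theta_def dist_Pair_Pair dist_real_def)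
  show ?thesis
  proof (rule that[of \<theta>' s u l])
    fix \<theta>'' assume *: "\<theta>'' \<in> Theta" "dist \<theta>'' \<theta>' < s"
    have "\<bar>snd \<theta>'' - (x + s)\<bar> < s"
      using dist_snd_le[of \<theta>'' \<theta>'] * by (simp add: \<theta>'_def dist_real_def)
    then have "snd \<theta> \<le> snd \<theta>''" by (simp add: \<theta>_eq)
    moreover have "dist \<theta>'' \<theta> < d"
      using dist_triangle[of \<theta>'' \<theta> \<theta>'] * dist s by linarith
    ultimately have "pullback n \<theta>'' M < u \<and> l < pullback n \<theta>'' (-M)"
      using d * by blast
    then show "phi_top \<theta>'' \<le> u \<and> l \<le> phi_bot \<theta>''"
      using phi_top_limit(2)[OF *(1), of n] phi_bot_limit(2)[OF *(1), of n] by linarith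
  qed (use \<open>\<theta>' \<in> Theta\<close> dist s n in \<open>auto simp: u_def l_def\<close>)
qed

section \<open>The envelopes of the bounding graphs\<close>

abbreviation env_top where "env_top \<equiv> usc_envelope Theta phi_top"
abbreviation env_bot where "env_bot \<equiv> usc_envelope Theta (\<lambda>\<theta>. - phi_bot \<theta>)"

lemma phi_bounded: "bdd_above (phi_top ` Theta)" "bdd_above ((\<lambda>\<theta>. - phi_bot \<theta>) ` Theta)"
  "bdd_below (phi_bot ` Theta)"
  using phi_range by (auto intro!: bdd_aboveI2[where M = M] bdd_belowI2[where m = "-M"] simp: minus_le_iff)

lemma phi_tilde_minus_eq_env: "\<theta> \<in> Theta \<Longrightarrow> phi_tilde_minus a M f \<theta> = - env_bot \<theta>"
  using phi_tilde_minus_eq[OF phi_bounded(3)] by simp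

lemma P_tilde_eq: "P_tilde a M f = {\<theta>\<in>Theta. env_top \<theta> = - env_bot \<theta>}"
  by (auto simp: P_tilde_def phi_tilde_plus_eq phi_tilde_minus_eq_env)

lemma C_tilde_plus_eq: "C_tilde_plus a M f = {\<theta>\<in>Theta. continuous (at \<theta> within Theta) env_top}"
  by (simp add: C_tilde_plus_def phi_tilde_plus_eq)

lemma C_tilde_minus_eq: "C_tilde_minus a M f = {\<theta>\<in>Theta. continuous (at \<theta> within Theta) env_bot}"
proof -
  have "continuous (at \<theta> within Theta) (phi_tilde_minus a M f) \<longleftrightarrow> continuous (at \<theta> within Theta) env_bot"
    if "\<theta> \<in> Theta" for \<theta>
  proof -
    have "continuous (at \<theta> within Theta) (phi_tilde_minus a M f) \<longleftrightarrow>
        continuous (at \<theta> within Theta) (\<lambda>\<theta>. - env_bot \<theta>)"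
      unfolding continuous_within using phi_tilde_minus_eq_env
      by (intro filterlim_cong refl) (auto simp: that eventually_at_filter)
    also have "\<dots> \<longleftrightarrow> continuous (at \<theta> within Theta) env_bot"
      unfolding continuous_within by (simp add: tendsto_minus_cancel_left[symmetric])
    finally show ?thesis .
  qed
  then show ?thesis by (auto simp: C_tilde_minus_def)
qed

lemma env_gap_nonneg: "\<theta> \<in> Theta \<Longrightarrow> phi_top \<theta> - phi_bot \<theta> \<le> env_top \<theta> + env_bot \<theta>"
  using usc_envelope_ge[OF phi_bounded(1)] usc_envelope_ge[OF phi_bounded(2)] by fastforce

lemma P_tilde_subset_P: "P_tilde a M f \<subseteq> P"
  unfolding P_tilde_eq P_set_def using env_gap_nonneg phi_bot_le_top by fastforce

lemma P_tilde_subset_C_tilde: "P_tilde a M f \<subseteq> C_tilde_plus a M f \<inter> C_tilde_minus a M f"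
  unfolding P_tilde_eq C_tilde_plus_eq C_tilde_minus_eq
  by (auto intro!: continuous_usc_envelope_if_touching[OF phi_bounded(1,2)]
      continuous_usc_envelope_if_touching[OF phi_bounded(2,1)] phi_bot_le_top)

lemma small_env_gap_nearby:
  assumes "P \<noteq> {}" "\<theta> \<in> Theta" "0 < \<epsilon>" "0 < r"
  obtains \<theta>' where "\<theta>' \<in> Theta" "dist \<theta>' \<theta> < r" "env_top \<theta>' + env_bot \<theta>' \<le> \<epsilon>"
proof -
  obtain \<theta>\<^sub>1 where \<theta>\<^sub>1: "\<theta>\<^sub>1 \<in> P" "dist \<theta>\<^sub>1 \<theta> < r / 2"
    using P_dense[OF assms(1,2), of "r / 2"] assms(4) by auto
  obtain \<theta>' s u l where *: "\<theta>' \<in> Theta" "dist \<theta>' \<theta>\<^sub>1 < r / 2" "0 < s" "u - l \<le> \<epsilon>"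
    "\<And>\<theta>''. \<theta>'' \<in> Theta \<Longrightarrow> dist \<theta>'' \<theta>' < s \<Longrightarrow> phi_top \<theta>'' \<le> u \<and> l \<le> phi_bot \<theta>''"
    using nearly_pinched_ball_near_P[OF \<theta>\<^sub>1(1) assms(3) half_gt_zero[OF assms(4)]] by blast
  have "env_top \<theta>' \<le> u" "env_bot \<theta>' \<le> - l"
    using * by (auto intro!: usc_envelope_le[of _ Theta \<theta>' s] phi_bounded)
  then show ?thesis
    using that[of \<theta>'] * \<theta>\<^sub>1 dist_triangle[of \<theta>' \<theta> \<theta>\<^sub>1] by linarith
qed

lemma C_tilde_subset_P_tilde:
  assumes "P \<noteq> {}"
  shows "C_tilde_plus a M f \<inter> C_tilde_minus a M f \<subseteq> P_tilde a M f"
proof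
  fix \<theta> assume "\<theta> \<in> C_tilde_plus a M f \<inter> C_tilde_minus a M f"
  then have \<theta>: "\<theta> \<in> Theta" and "continuous (at \<theta> within Theta) (\<lambda>\<theta>. env_top \<theta> + env_bot \<theta>)"
    by (auto simp: C_tilde_plus_eq C_tilde_minus_eq intro: continuous_add)
  then have cont: "\<exists>d>0. \<forall>\<theta>'\<in>Theta. dist \<theta>' \<theta> < d \<longrightarrow>
      dist (env_top \<theta>' + env_bot \<theta>') (env_top \<theta> + env_bot \<theta>) < e" if "0 < e" for e
    using that by (auto simp: continuous_within_eps_delta)
  have "env_top \<theta> + env_bot \<theta> \<le> 0"
  proof (rule ccontr)
    define \<epsilon> where "\<epsilon> = (env_top \<theta> + env_bot \<theta>) / 2"
    assume "\<not> env_top \<theta> + env_bot \<theta> \<le> 0"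
    then have \<epsilon>: "0 < \<epsilon>" by (simp add: \<epsilon>_def)
    obtain d where d: "0 < d" "\<And>\<theta>'. \<theta>' \<in> Theta \<Longrightarrow> dist \<theta>' \<theta> < d \<Longrightarrow>
        dist (env_top \<theta>' + env_bot \<theta>') (env_top \<theta> + env_bot \<theta>) < \<epsilon>"
      using cont[OF \<epsilon>] by blast
    obtain \<theta>' where "\<theta>' \<in> Theta" "dist \<theta>' \<theta> < d" "env_top \<theta>' + env_bot \<theta>' \<le> \<epsilon>"
      using small_env_gap_nearby[OF assms \<theta> \<epsilon> d(1)] by blast
    with d(2)[of \<theta>'] \<epsilon> show False
      by (simp add: \<epsilon>_def dist_real_def abs_if split: if_splits)
  qed
  then show "\<theta> \<in> P_tilde a M f"
    using env_gap_nonneg[OF \<theta>] phi_bot_le_top[OF \<theta>] \<theta> by (simp add: P_tilde_eq)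
qed

end

section \<open>The standing hypotheses\<close>

text \<open>The derivatives are one-sided at the end points of the interval, and their boundedness comes
  from continuity on a compact set.\<close>

lemma C3_on_derivative:
  assumes "C3_on {-M..M} g"
  shows "\<And>y. y \<in> {-M..M} \<Longrightarrow> (g has_vector_derivative nderiv_on {-M..M} 1 g y) (at y within {-M..M})"
    and "bounded (nderiv_on {-M..M} 1 g ` {-M..M})"
proof -
  have "nderiv_on {-M..M} 0 g differentiable_on {-M..M}" "nderiv_on {-M..M} 1 g differentiable_on {-M..M}"
    using assms unfolding C3_on_def by auto
  then show "\<And>y. y \<in> {-M..M} \<Longrightarrow> (g has_vector_derivative nderiv_on {-M..M} 1 g y) (at y within {-M..M})"
    and "bounded (nderiv_on {-M..M} 1 g ` {-M..M})"
    by (auto simp: nderiv_on_def differentiable_on_def vector_derivative_works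
        intro!: compact_imp_bounded compact_continuous_image differentiable_imp_continuous_on)
qed

text \<open>By the mean value theorem, the supremum of the derivatives is a Lipschitz constant in the fibre;
  monotonicity takes care of the sign of the increments. For the base, both suprema in hypothesis (A)
  must be shown to be suprema of bounded families: the first in order to bound the values of the
  functions, the second in order to know that it is nonnegative and can be dropped. The constant in
  (A) may be negative, hence its absolute value. The horizontal distance of a point to the section is
  at most \<open>1\<close>, which leaves the constant \<open>C\<close> of (B) unchanged.\<close>

lemma contracted_skew_product_of_hypotheses:
  assumes a: "0 < a" "a < 1" and M: "0 < M"
    and fib: "fibre_maps M f" and A: "hyp_A M f" and B: "hyp_B a \<alpha>" and C: "hyp_C M f \<alpha>"
  shows "\<exists>\<Lambda> K D \<sigma>. contracted_skew_product a M \<Lambda> K D \<alpha> f \<sigma>"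
proof -
  let ?I = "{-M..M}"
  let ?f' = "\<lambda>\<theta>. nderiv_on ?I 1 (f \<theta>)"
  define \<Lambda> where "\<Lambda> = (SUP (\<theta>, y)\<in>Theta \<times> ?I. ?f' \<theta> y)"
  have range: "f \<theta> y \<in> {-M<..<M}" if "\<theta> \<in> Theta" "y \<in> ?I" for \<theta> y
    using fib that unfolding fibre_maps_def by blast
  have mono: "strict_mono_on ?I (f \<theta>)" and C3: "C3_on ?I (f \<theta>)" if "\<theta> \<in> Theta" for \<theta>
    using fib that unfolding fibre_maps_def by blast+
  have f'_le: "?f' \<theta> y \<le> \<Lambda>" if "\<theta> \<in> Theta" "y \<in> ?I" for \<theta> y
    unfolding \<Lambda>_def using C that cSUP_upper[of "(\<theta>, y)" "Theta \<times> ?I" "\<lambda>(\<theta>, y). ?f' \<theta> y"]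
    by (auto simp: hyp_C_def)
  have f'_bounded: "\<exists>b. \<forall>y\<in>?I. \<bar>?f' \<theta> y\<bar> \<le> b" if "\<theta> \<in> Theta" for \<theta>
    using C3_on_derivative(2)[OF C3[OF that]] by (simp add: bounded_iff)
  have increment: "0 < f \<theta> z - f \<theta> y \<and> f \<theta> z - f \<theta> y \<le> \<Lambda> * (z - y)"
    if \<theta>: "\<theta> \<in> Theta" and yz: "y \<in> ?I" "z \<in> ?I" "y < z" for \<theta> y z
  proof -
    have "(f \<theta> has_derivative (\<lambda>h. h * ?f' \<theta> w)) (at w within {y..z})" if "w \<in> {y..z}" for w
      using C3_on_derivative(1)[OF C3[OF \<theta>], of w] that yz
      by (auto simp: has_vector_derivative_def intro: has_derivative_subset)
    then obtain w where w: "w \<in> {y<..<z}" "f \<theta> z - f \<theta> y = (z - y) * ?f' \<theta> w"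
      using mvt_simple[OF yz(3), of "f \<theta>" "\<lambda>w h. h * ?f' \<theta> w"] by auto
    have "(z - y) * ?f' \<theta> w \<le> (z - y) * \<Lambda>"
      using w yz by (intro mult_left_mono f'_le \<theta>) auto
    then show ?thesis
      using w strict_mono_onD[OF mono[OF \<theta>] yz] by (simp add: mult.commute)
  qed
  have zero: "(0, 0) \<in> Theta" by (simp add: Theta_def)
  have "0 < f (0, 0) M - f (0, 0) (-M) \<and> f (0, 0) M - f (0, 0) (-M) \<le> \<Lambda> * (M - - M)"
    using M by (intro increment zero) auto
  then have "0 < \<Lambda> * (M - - M)" by linarith
  then have \<Lambda>: "0 \<le> \<Lambda>"
    using M by (auto simp: zero_less_mult_iff)
  have lip: "\<bar>f \<theta> y - f \<theta> z\<bar> \<le> \<Lambda> * \<bar>y - z\<bar>" if "\<theta> \<in> Theta" "y \<in> ?I" "z \<in> ?I" for \<theta> y z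
    using increment[OF that] increment[OF that(1,3,2)] by (cases y z rule: linorder_cases) auto
  obtain K\<^sub>0 where K\<^sub>0: "\<And>\<theta> \<theta>'. \<theta> \<in> Theta \<Longrightarrow> \<theta>' \<in> Theta \<Longrightarrow>
      (SUP y\<in>?I. \<bar>f \<theta> y - f \<theta>' y\<bar>) + (SUP y\<in>?I. \<bar>?f' \<theta> y - ?f' \<theta>' y\<bar>) \<le> K\<^sub>0 * torus_dist \<theta> \<theta>'"
    using A unfolding hyp_A_def by blast
  have lip_base: "\<bar>f \<theta> y - f \<theta>' y\<bar> \<le> \<bar>K\<^sub>0\<bar> * torus_dist \<theta> \<theta>'"
    if t: "\<theta> \<in> Theta" "\<theta>' \<in> Theta" and y: "y \<in> ?I" for \<theta> \<theta>' y
  proof -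
    have "\<bar>f \<theta> z - f \<theta>' z\<bar> \<le> 2 * M" if "z \<in> ?I" for z
      using range[OF t(1) that] range[OF t(2) that] by auto
    then have 1: "\<bar>f \<theta> y - f \<theta>' y\<bar> \<le> (SUP y\<in>?I. \<bar>f \<theta> y - f \<theta>' y\<bar>)"
      by (intro cSUP_upper y bdd_aboveI2)
    obtain b b' where "\<forall>z\<in>?I. \<bar>?f' \<theta> z\<bar> \<le> b" "\<forall>z\<in>?I. \<bar>?f' \<theta>' z\<bar> \<le> b'"
      using f'_bounded[OF t(1)] f'_bounded[OF t(2)] by blast
    then have "\<bar>?f' \<theta> z - ?f' \<theta>' z\<bar> \<le> b + b'" if "z \<in> ?I" for z
      using that by (intro order_trans[OF abs_triangle_ineq4 add_mono]) auto
    then have "\<bar>?f' \<theta> y - ?f' \<theta>' y\<bar> \<le> (SUP y\<in>?I. \<bar>?f' \<theta> y - ?f' \<theta>' y\<bar>)"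
      by (intro cSUP_upper y bdd_aboveI2)
    then have "\<bar>f \<theta> y - f \<theta>' y\<bar> \<le> K\<^sub>0 * torus_dist \<theta> \<theta>'"
      using 1 K\<^sub>0[OF t] by linarith
    also have "\<dots> \<le> \<bar>K\<^sub>0\<bar> * torus_dist \<theta> \<theta>'"
      by (intro mult_right_mono) (auto simp: torus_dist_def infdist_nonneg)
    finally show ?thesis .
  qed
  obtain \<sigma> C where \<sigma>: "\<sigma> ` {0..<1} \<subseteq> Theta" "\<forall>x\<in>{0..<1}. snd (\<sigma> x) = x" and "0 < C"
    and contr: "\<forall>\<theta>\<in>Theta. \<forall>n>0. torus_dist ((baker_inv a ^^ n) \<theta>) ((baker_inv a ^^ n) (\<sigma> (snd \<theta>)))
      \<le> C * \<alpha> ^ n * torus_dist \<theta> (\<sigma> (snd \<theta>))" and \<alpha>: "0 < \<alpha>" "\<alpha> < 1"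
    using B unfolding hyp_B_def by blast
  have "contracted_skew_product a M \<Lambda> \<bar>K\<^sub>0\<bar> C \<alpha> f \<sigma>"
  proof (unfold_locales)
    show "\<alpha> * \<Lambda> < 1"
      using C unfolding hyp_C_def \<Lambda>_def by blast
    fix \<theta> n assume \<theta>: "\<theta> \<in> Theta" and n: "0 < (n::nat)"
    have x: "snd \<theta> \<in> {0..<1}" "fst \<theta> \<in> {0..<1}" using \<theta> by (auto simp: Theta_def)
    have "\<sigma> (snd \<theta>) \<in> Theta" "snd (\<sigma> (snd \<theta>)) = snd \<theta>" using \<sigma> x by auto
    then have "dist \<theta> (\<sigma> (snd \<theta>)) = \<bar>fst \<theta> - fst (\<sigma> (snd \<theta>))\<bar>"
      by (simp add: dist_prod_def dist_real_def)
    also have "\<dots> \<le> 1"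
      using x \<open>\<sigma> (snd \<theta>) \<in> Theta\<close> by (auto simp: Theta_def)
    finally have "torus_dist \<theta> (\<sigma> (snd \<theta>)) \<le> 1"
      using torus_dist_le_dist order_trans by blast
    then have "C * \<alpha> ^ n * torus_dist \<theta> (\<sigma> (snd \<theta>)) \<le> C * \<alpha> ^ n"
      using \<open>0 < C\<close> \<alpha> by (intro mult_left_le) auto
    then show "torus_dist ((baker_inv a ^^ n) \<theta>) ((baker_inv a ^^ n) (\<sigma> (snd \<theta>))) \<le> C * \<alpha> ^ n"
      using contr \<theta> n order_trans by blast
  qed (use a M range mono \<Lambda> lip lip_base \<alpha> \<sigma> \<open>0 < C\<close> in \<open>auto simp: less_imp_le\<close>)
  then show ?thesis by blast
qed

theorem theorem3p9:
  fixes a M \<alpha> :: real and f :: "real \<times> real \<Rightarrow> real \<Rightarrow> real"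
  assumes "0 < a" and "a < 1" and "0 < M"
    and "fibre_maps M f"
    and "hyp_A M f"
    and "hyp_B a \<alpha>"
    and "hyp_C M f \<alpha>"
  shows "P_set a M f \<subseteq> L_set a \<or>
    (C_tilde_plus a M f \<inter> C_tilde_minus a M f = P_tilde a M f \<and> P_tilde a M f \<subseteq> P_set a M f)"
proof -
  obtain \<Lambda> K D \<sigma> where "contracted_skew_product a M \<Lambda> K D \<alpha> f \<sigma>"
    using contracted_skew_product_of_hypotheses[OF assms] by blast
  then interpret contracted_skew_product a M \<Lambda> K D \<alpha> f \<sigma> .
  show ?thesis
    using C_tilde_subset_P_tilde P_tilde_subset_C_tilde P_tilde_subset_P by blast
qed

end
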